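(* (Equivariant Dilworth theorem.) Let $P$ be a partially ordered set of width $d<\infty$ with an order-preserving free action by an infinite cyclic group $\langle g\rangle$. Suppose further that there is an antichain $A$ in $P$ of cardinality $d$ that is both $\langle g\rangle$-descending and spans $P$. Then there is a $\langle g\rangle$-invariant partition of $P$ into $d$ chains whose intersection with $[A,gA]$ is a Dilworth partition of $[A,gA]$ which includes a maximal chain in $[A,gA]$.
   Context: A chain in a poset is a linearly ordered subset; it is maximal if not properly contained in another chain. An antichain is a subset no two distinct elements of which are comparable. The width of a poset is the maximal cardinality of an antichain. A Dilworth partition of a poset of finite width $d$ is a partition of it into $d$ chains. An antichain $A\subseteq P$ is $\langle g\rangle$-descending if $ga\not> a'$ for all $a,a'\in A$. It spans $P$ if for each $p\in P$ there exist $a,a'\in A$ and $r,s\in\mathbb Z$ with $g^ra>p>g^sa'$. Define $[A,gA]=\{p\in P: x\ge p\ge y\text{ for some }x,y\in A\cup gA\}$ (if $A$ is $\langle g\rangle$-descending this equals $\{p\in P : x\ge p\ge y\text{ for some } x\in A,\ y\in gA\}$). A partition is $\langle g\rangle$-invariant if $g$ permutes its members. *)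

theory Defs
  imports "HOL-Algebra.Group_Action" "HOL-Algebra.Generated_Groups" "HOL-Library.Disjoint_Sets"
begin

text \<open>
  Posets are subsets of a type of class \<^class>\<open>order\<close>, with the induced order. Chains and maximal
  chains of such a subset \<open>S\<close> are \<^const>\<open>pred_on.chain\<close> and \<^const>\<open>pred_on.maxchain\<close> for the
  strict order \<open>(<)\<close>, of which \<^locale>\<open>pred_on\<close> takes the reflexive closure.
\<close>

definition antichain :: "'a::order set \<Rightarrow> bool" where
  "antichain A \<longleftrightarrow> (\<forall>x\<in>A. \<forall>y\<in>A. x \<noteq> y \<longrightarrow> \<not> x \<le> y \<and> \<not> y \<le> x)"

text \<open>Finite width: infinite antichains have \<^const>\<open>card\<close> 0, so finiteness is stated separately.\<close>

definition has_width :: "'a::order set \<Rightarrow> nat \<Rightarrow> bool" where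
  "has_width S d \<longleftrightarrow>
     (\<exists>A\<subseteq>S. antichain A \<and> finite A \<and> card A = d) \<and>
     (\<forall>A\<subseteq>S. antichain A \<longrightarrow> finite A \<and> card A \<le> d)"

text \<open>The members of a partition are nonempty (\<^const>\<open>partition_on\<close>).\<close>

definition chain_partition :: "'a::order set \<Rightarrow> nat \<Rightarrow> 'a set set \<Rightarrow> bool" where
  "chain_partition S d \<C> \<longleftrightarrow>
     partition_on S \<C> \<and> (\<forall>C\<in>\<C>. pred_on.chain S (<) C) \<and> finite \<C> \<and> card \<C> = d"

definition dilworth_partition :: "'a::order set \<Rightarrow> 'a set set \<Rightarrow> bool" where
  "dilworth_partition S \<C> \<longleftrightarrow> (\<exists>d. has_width S d \<and> chain_partition S d \<C>)"

text \<open>In the following, \<open>\<phi> h\<close> is the permutation by which the group element \<open>h\<close> acts.\<close>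

definition descending :: "('b \<Rightarrow> 'a::order \<Rightarrow> 'a) \<Rightarrow> 'b \<Rightarrow> 'a set \<Rightarrow> bool" where
  "descending \<phi> g A \<longleftrightarrow> (\<forall>a\<in>A. \<forall>a'\<in>A. \<not> \<phi> g a > a')"

definition spans ::
  "('b, 'c) monoid_scheme \<Rightarrow> ('b \<Rightarrow> 'a::order \<Rightarrow> 'a) \<Rightarrow> 'b \<Rightarrow> 'a set \<Rightarrow> 'a set \<Rightarrow> bool" where
  "spans G \<phi> g A P \<longleftrightarrow>
     (\<forall>p\<in>P. \<exists>a\<in>A. \<exists>a'\<in>A. \<exists>(r::int) (s::int).
        \<phi> (g [^]\<^bsub>G\<^esub> r) a > p \<and> p > \<phi> (g [^]\<^bsub>G\<^esub> s) a')"

text \<open>For \<open>B = gA\<close> this is the set written \<open>[A,gA]\<close>.\<close>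

definition between :: "'a::order set \<Rightarrow> 'a set \<Rightarrow> 'a set" where
  "between A B = {p. \<exists>x\<in>A \<union> B. \<exists>y\<in>A \<union> B. x \<ge> p \<and> p \<ge> y}"

definition invariant_under :: "('a \<Rightarrow> 'a) \<Rightarrow> 'a set set \<Rightarrow> bool" where
  "invariant_under f \<C> \<longleftrightarrow> bij_betw (image f) \<C> \<C>"

end

theory Submission
  imports Defs
begin

text \<open>
  Dilworth's theorem splits \<open>[A, gA]\<close> into \<open>d\<close> chains, one of which can be made a maximal chain by
  taking elements away from the others. Each chain contains exactly one element of \<open>A\<close>, at its top,
  and exactly one of \<open>gA\<close>, at its bottom. The translates of \<open>[A, gA]\<close> cover the poset and consecutive
  ones meet only in a translate of \<open>A\<close>, so the translated chains can be glued end to end; this gives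
  \<open>d\<close> chains that \<open>g\<close> permutes.
\<close>

section \<open>Dilworth's theorem for posets of finite width\<close>

lemma antichain_subset: "antichain B \<Longrightarrow> C \<subseteq> B \<Longrightarrow> antichain C"
  by (auto simp: antichain_def)

lemma antichain_card_le_if_no_card_Suc:
  assumes no: "\<And>B. B \<subseteq> S \<Longrightarrow> antichain B \<Longrightarrow> card B \<noteq> Suc e"
    and B: "B \<subseteq> S" "antichain B"
  shows "card B \<le> e"
proof (rule ccontr)
  assume "\<not> card B \<le> e"
  then obtain C where C: "C \<subseteq> B" "card C = Suc e"
    by (metis not_less_eq_eq obtain_subset_with_card_n)
  moreover have "C \<subseteq> S" "antichain C"
    using B C antichain_subset by auto
  ultimately show False
    using no by blast
qed

text \<open>Galvin's proof: a maximal element together with the part of one colour class below the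
  topmost element that lies in an antichain of full size meets every such antichain.\<close>

lemma finite_chain_coloring:
  fixes S :: "'a::order set"
  assumes "finite S" and "\<And>B. B \<subseteq> S \<Longrightarrow> antichain B \<Longrightarrow> card B \<le> d"
  shows "\<exists>f::'a \<Rightarrow> nat. f ` S \<subseteq> {..<d} \<and> (\<forall>x\<in>S. \<forall>y\<in>S. f x = f y \<longrightarrow> x \<le> y \<or> y \<le> x)"
  using assms
proof (induction S arbitrary: d rule: finite_psubset_induct)
  case (psubset S)
  show ?case
  proof (cases "S = {}")
    case False
    then obtain m where m: "m \<in> S" "\<And>x. x \<in> S \<Longrightarrow> m \<le> x \<Longrightarrow> m = x"
      using finite_has_maximal[OF psubset.hyps] by blast
    have "antichain {m}"
      by (simp add: antichain_def)
    from psubset.prems[OF _ this] m have "1 \<le> d"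
      by auto
    then obtain e where d: "d = Suc e"
      by (cases d) auto
    \<comment> \<open>Removing a chain \<open>K\<close> that meets every antichain of size
      \<open>d\<close> lowers the bound to \<open>e\<close>; induction colours \<open>S - K\<close>
      with \<open>e\<close> colours, and \<open>K\<close> gets the new colour
      \<open>e\<close>.\<close>
    have split_off: ?thesis
      if K: "m \<in> K" "K \<subseteq> S" "\<And>x y. x \<in> K \<Longrightarrow> y \<in> K \<Longrightarrow> x \<le> y \<or> y \<le> x"
        and no: "\<And>B. B \<subseteq> S - K \<Longrightarrow> antichain B \<Longrightarrow> card B \<noteq> Suc e" for K
    proof -
      have "S - K \<subset> S"
        using K m by auto
      from psubset.IH[OF this, of e] antichain_card_le_if_no_card_Suc[OF no]
      obtain f :: "'a \<Rightarrow> nat" where f: "f ` (S - K) \<subseteq> {..<e}"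
        "\<And>x y. x \<in> S - K \<Longrightarrow> y \<in> S - K \<Longrightarrow> f x = f y \<Longrightarrow> x \<le> y \<or> y \<le> x"
        by metis
      have "f x \<noteq> e" if "x \<in> S - K" for x
        using f(1) that by auto
      then show ?thesis
        using f K d by (intro exI[of _ "\<lambda>x. if x \<in> K then e else f x"]) (auto simp: less_Suc_eq)
    qed
    define S' where "S' = S - {m}"
    show ?thesis
    proof (cases "\<exists>B\<subseteq>S'. antichain B \<and> card B = d")
      case False
      then show ?thesis
        using m d by (intro split_off[of "{m}"]) (auto simp: S'_def)
    next
      case True
      have "S' \<subset> S" "finite S'"
        using m psubset.hyps by (auto simp: S'_def)
      from psubset.IH[OF this(1), of d] psubset.prems this(1)
      obtain f :: "'a \<Rightarrow> nat" where f: "f ` S' \<subseteq> {..<d}"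
        "\<And>x y. x \<in> S' \<Longrightarrow> y \<in> S' \<Longrightarrow> f x = f y \<Longrightarrow> x \<le> y \<or> y \<le> x"
        by (metis psubsetE subset_trans)
      have hit: "\<exists>y\<in>B. f y = i" if B: "B \<subseteq> S'" "antichain B" "card B = d" and "i < d" for B i
      proof -
        have "inj_on f B"
          using B f(2) unfolding inj_on_def antichain_def by blast
        then have "f ` B = {..<d}"
          using B f(1) by (intro card_subset_eq) (auto simp: card_image)
        then have "i \<in> f ` B"
          using \<open>i < d\<close> by simp
        then show ?thesis
          by blast
      qed
      define X where "X i = {x \<in> S'. f x = i \<and> (\<exists>B\<subseteq>S'. antichain B \<and> card B = d \<and> x \<in> B)}" for i
      have "\<exists>x\<in>X i. \<forall>y\<in>X i. y \<le> x" if "i < d" for i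
      proof -
        from True obtain B where B: "B \<subseteq> S'" "antichain B" "card B = d"
          by blast
        then obtain b where "b \<in> B" "f b = i"
          using hit[OF B \<open>i < d\<close>] by blast
        then have "X i \<noteq> {}"
          using B by (auto simp: X_def)
        moreover have "finite (X i)"
          using \<open>finite S'\<close> by (auto simp: X_def)
        ultimately obtain x where x: "x \<in> X i" "\<And>y. y \<in> X i \<Longrightarrow> x \<le> y \<Longrightarrow> x = y"
          using finite_has_maximal[of "X i"] by blast
        then have "y \<le> x" if "y \<in> X i" for y
          using f(2)[of x y] that by (auto simp: X_def)
        with x show ?thesis by blast
      qed
      then obtain t where t: "\<And>i. i < d \<Longrightarrow> t i \<in> X i" "\<And>i y. i < d \<Longrightarrow> y \<in> X i \<Longrightarrow> y \<le> t i"
        by metis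
      have t_col: "f (t i) = i" "t i \<in> S'" if "i < d" for i
        using t(1)[OF that] by (auto simp: X_def)
      \<comment> \<open>An antichain of size \<open>d\<close> through \<open>t i\<close> has an
        element \<open>y\<close> of colour \<open>j\<close>; then
        \<open>y \<le> t j \<le> t i\<close> forces \<open>y = t i\<close>, whose colour is
        \<open>i\<close>.\<close>
      have t_incomp: "\<not> t j \<le> t i" if ij: "i < d" "j < d" "i \<noteq> j" for i j
      proof
        assume le: "t j \<le> t i"
        obtain B where B: "B \<subseteq> S'" "antichain B" "card B = d" "t i \<in> B"
          using t(1)[OF ij(1)] by (auto simp: X_def)
        obtain y where y: "y \<in> B" "f y = j"
          using hit[OF B(1-3) ij(2)] by blast
        then have "y \<in> X j"
          using B by (auto simp: X_def)
        then have "y \<le> t i"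
          using t(2)[OF ij(2)] le by force
        then have "y = t i"
          using B y unfolding antichain_def by blast
        then show False
          using y t_col ij by simp
      qed
      \<comment> \<open>Otherwise \<open>m\<close>, being maximal, is incomparable to every
        \<open>t i\<close>, and together they form an antichain of size
        \<open>d + 1\<close>.\<close>
      have "\<exists>i<d. t i \<le> m"
      proof (rule ccontr)
        assume none: "\<not> (\<exists>i<d. t i \<le> m)"
        have not_le: "\<not> m \<le> t i" if "i < d" for i
          using m(2)[of "t i"] t_col[OF that] by (auto simp: S'_def)
        have "inj_on t {..<d}"
          by (metis inj_onI lessThan_iff t_col(1))
        moreover have "m \<notin> t ` {..<d}"
          using t_col by (auto simp: S'_def)
        ultimately have "card (insert m (t ` {..<d})) = Suc d"
          by (simp add: card_image)
        moreover have "antichain (insert m (t ` {..<d}))"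
          unfolding antichain_def
        proof (intro ballI impI)
          fix x y assume "x \<in> insert m (t ` {..<d})" "y \<in> insert m (t ` {..<d})" "x \<noteq> y"
          then consider "x = m" "\<exists>i<d. y = t i" | "y = m" "\<exists>i<d. x = t i"
            | i j where "i < d" "j < d" "i \<noteq> j" "x = t i" "y = t j"
            by blast
          then show "\<not> x \<le> y \<and> \<not> y \<le> x"
            by cases (use none not_le t_incomp in blast)+
        qed
        moreover have "insert m (t ` {..<d}) \<subseteq> S"
          using m t_col by (auto simp: S'_def)
        ultimately show False
          using psubset.prems[of "insert m (t ` {..<d})"] by simp
      qed
      then obtain i where i: "i < d" "t i \<le> m"
        by blast
      show ?thesis
      proof (rule split_off[of "insert m {z \<in> S'. f z = i \<and> z \<le> t i}"])
        fix B assume B: "B \<subseteq> S - insert m {z \<in> S'. f z = i \<and> z \<le> t i}" "antichain B"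
        show "card B \<noteq> Suc e"
        proof
          assume "card B = Suc e"
          moreover have BS: "B \<subseteq> S'"
            using B by (auto simp: S'_def)
          ultimately obtain y where y: "y \<in> B" "f y = i"
            using hit[of B i] B d i by blast
          then have "y \<in> X i"
            using B BS \<open>card B = Suc e\<close> d by (auto simp: X_def)
          then show False
            using t(2)[OF i(1)] y B BS by blast
        qed
      next
        fix x y
        assume "x \<in> insert m {z \<in> S'. f z = i \<and> z \<le> t i}"
          and "y \<in> insert m {z \<in> S'. f z = i \<and> z \<le> t i}"
        then show "x \<le> y \<or> y \<le> x"
          using f(2)[of x y] i(2) by (auto intro: order_trans)
      qed (use m in \<open>auto simp: S'_def\<close>)
    qed
  qed auto
qed

section \<open>Compactness of graph colourings and infinite posets\<close>

definition proper_coloring :: "'a rel \<Rightarrow> nat \<Rightarrow> 'a set \<Rightarrow> ('a \<Rightarrow> nat) \<Rightarrow> bool" where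
  "proper_coloring E d K f \<longleftrightarrow> f ` K \<subseteq> {..<d} \<and> (\<forall>x\<in>K. \<forall>y\<in>K. (x, y) \<in> E \<longrightarrow> f x \<noteq> f y)"

lemma proper_coloring_mono:
  "proper_coloring E d K f \<Longrightarrow> E' \<inter> K' \<times> K' \<subseteq> E \<Longrightarrow> K' \<subseteq> K \<Longrightarrow> proper_coloring E' d K' f"
  unfolding proper_coloring_def by blast

text \<open>The de Bruijn--Erdos theorem. In an edge set that is maximal among those all of whose finite
  restrictions are colourable, non-adjacency is an equivalence relation.\<close>

theorem coloring_compactness:
  assumes fin: "\<And>K. finite K \<Longrightarrow> K \<subseteq> V \<Longrightarrow> \<exists>f. proper_coloring E d K f"
  shows "\<exists>f. proper_coloring E d V f"
proof -
  define \<A> where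
    "\<A> = {E'. E \<subseteq> E' \<and> (\<forall>K. finite K \<and> K \<subseteq> V \<longrightarrow> (\<exists>f. proper_coloring E' d K f))}"
  have "\<exists>M\<in>\<A>. \<forall>X\<in>\<A>. M \<subseteq> X \<longrightarrow> X = M"
  proof (rule subset_Zorn_nonempty)
    show "\<A> \<noteq> {}"
      using fin by (auto simp: \<A>_def)
    fix \<C> assume \<C>: "\<C> \<noteq> {}" "subset.chain \<A> \<C>"
    then have sub: "\<C> \<subseteq> \<A>"
      by (simp add: subset.chain_def)
    have "\<exists>f. proper_coloring (\<Union>\<C>) d K f" if K: "finite K" "K \<subseteq> V" for K
    proof -
      have "finite (\<Union>\<C> \<inter> K \<times> K)"
        using K by auto
      then obtain D where D: "D \<in> \<C>" "\<Union>\<C> \<inter> K \<times> K \<subseteq> D"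
        using finite_subset_Union_chain[OF _ _ \<C>] by blast
      with K sub obtain f where "proper_coloring D d K f"
        unfolding \<A>_def by blast
      then show ?thesis
        using proper_coloring_mono D(2) by blast
    qed
    then show "\<Union>\<C> \<in> \<A>"
      using \<C> sub by (fastforce simp: \<A>_def)
  qed
  then obtain M where M: "M \<in> \<A>" and max: "\<And>X. X \<in> \<A> \<Longrightarrow> M \<subseteq> X \<Longrightarrow> X = M"
    by blast
  \<comment> \<open>\<open>K\<close> is a finite certificate that \<open>x\<close> and
    \<open>y\<close> always get the same colour. By maximality of \<open>M\<close>, certificates
    exist for exactly the pairs of points of \<open>V\<close> outside \<open>M\<close>.\<close>
  define forced where "forced x y K \<longleftrightarrow> finite K \<and> K \<subseteq> V \<and> x \<in> K \<and> y \<in> K \<and>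
    (\<forall>f. proper_coloring M d K f \<longrightarrow> f x = f y)" for x y K
  have colM: "\<exists>f. proper_coloring M d K f" if "finite K" "K \<subseteq> V" for K
    using M that by (auto simp: \<A>_def)
  have nonadj: "\<exists>K. forced x y K" if xy: "x \<in> V" "y \<in> V" "(x, y) \<notin> M" for x y
  proof -
    have "insert (x, y) M \<notin> \<A>"
      using max xy by blast
    then obtain K where K: "finite K" "K \<subseteq> V" "\<And>f. \<not> proper_coloring (insert (x, y) M) d K f"
      using M by (auto simp: \<A>_def)
    have "f x = f y" if f: "proper_coloring M d (insert x (insert y K)) f" for f
    proof (rule ccontr)
      assume "f x \<noteq> f y"
      then have "proper_coloring (insert (x, y) M) d K f"
        using f unfolding proper_coloring_def by auto
      then show False
        using K by blast
    qed
    then show ?thesis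
      using K xy by (intro exI[of _ "insert x (insert y K)"]) (auto simp: forced_def)
  qed
  have adj: "(x, y) \<notin> M" if "forced x y K" for x y K
    using that colM[of K] unfolding forced_def proper_coloring_def by blast
  define R where "R = {(x, y). \<exists>K. forced x y K}"
  have "equiv V R"
  proof (rule equivI)
    show "R \<subseteq> V \<times> V"
      by (auto simp: R_def forced_def)
    show "refl_on V R"
    proof (rule refl_onI)
      fix x assume "x \<in> V"
      then have "forced x x {x}"
        by (auto simp: forced_def)
      then show "(x, x) \<in> R"
        by (auto simp: R_def)
    qed
    show "sym R"
    proof (rule symI)
      fix x y assume "(x, y) \<in> R"
      then obtain K where "forced x y K"
        by (auto simp: R_def)
      then have "forced y x K"
        unfolding forced_def by metis
      then show "(y, x) \<in> R"
        by (auto simp: R_def)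
    qed
    show "trans R"
    proof (rule transI)
      fix x y z assume "(x, y) \<in> R" "(y, z) \<in> R"
      then obtain K L where KL: "forced x y K" "forced y z L"
        by (auto simp: R_def)
      have "f x = f z" if f: "proper_coloring M d (K \<union> L) f" for f
      proof -
        have "proper_coloring M d K f" "proper_coloring M d L f"
          using proper_coloring_mono[OF f] by blast+
        then show ?thesis
          using KL unfolding forced_def by metis
      qed
      then have "forced x z (K \<union> L)"
        using KL by (auto simp: forced_def)
      then show "(x, z) \<in> R"
        by (auto simp: R_def)
    qed
  qed
  \<comment> \<open>Representatives of distinct classes are pairwise joined in \<open>M\<close>, so
    a proper colouring of finitely many of them is injective.\<close>
  have "finite (V // R) \<and> card (V // R) \<le> d"
  proof (rule finite_if_finite_subsets_card_bdd)
    fix \<G> assume \<G>: "\<G> \<subseteq> V // R" "finite \<G>"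
    define rep where "rep X = (SOME x. x \<in> X)" for X :: "'a set"
    have rep: "rep X \<in> X" if "X \<in> \<G>" for X
      using that \<G> \<open>equiv V R\<close> in_quotient_imp_non_empty unfolding rep_def
      by (metis some_in_eq subsetD)
    have repV: "rep ` \<G> \<subseteq> V"
      using rep \<G> \<open>equiv V R\<close> in_quotient_imp_subset by blast
    then obtain f where f: "proper_coloring M d (rep ` \<G>) f"
      using colM \<G> by blast
    have "inj_on (f \<circ> rep) \<G>"
    proof (rule inj_onI, rule ccontr)
      fix X Y assume XY: "X \<in> \<G>" "Y \<in> \<G>" "(f \<circ> rep) X = (f \<circ> rep) Y" "X \<noteq> Y"
      then have "(rep X, rep Y) \<notin> R"
        using rep \<G> quotient_eq_iff[OF \<open>equiv V R\<close>] by blast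
      then have "(rep X, rep Y) \<in> M"
        using nonadj[of "rep X" "rep Y"] repV XY(1,2) unfolding R_def by blast
      then show False
        using f XY by (auto simp: proper_coloring_def)
    qed
    moreover have "(f \<circ> rep) ` \<G> \<subseteq> {..<d}"
      using f by (auto simp: proper_coloring_def)
    ultimately show "card \<G> \<le> d"
      using card_inj_on_le[of "f \<circ> rep" \<G> "{..<d}"] by simp
  qed
  then obtain h :: "'a set \<Rightarrow> nat" where h: "inj_on h (V // R)" "h ` (V // R) \<subseteq> {..<d}"
    by (metis card_le_inj card_lessThan finite_lessThan)
  have "h (R `` {x}) \<noteq> h (R `` {y})" if "x \<in> V" "y \<in> V" "(x, y) \<in> E" for x y
  proof
    assume "h (R `` {x}) = h (R `` {y})"
    then have "R `` {x} = R `` {y}"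
      using h(1) that by (meson inj_onD quotientI)
    then have "(x, y) \<in> R"
      using \<open>equiv V R\<close> that by (simp add: eq_equiv_class)
    then show False
      using adj M that by (auto simp: R_def \<A>_def)
  qed
  then have "proper_coloring E d V (\<lambda>x. h (R `` {x}))"
    using h(2) quotientI[of _ V R] unfolding proper_coloring_def by blast
  then show ?thesis
    by blast
qed

text \<open>Colourings with chains as colour classes are the proper colourings of the
  incomparability graph, so compactness passes from finite subsets to \<open>S\<close>.\<close>

lemma chain_coloring:
  fixes S :: "'a::order set"
  assumes "\<And>B. B \<subseteq> S \<Longrightarrow> antichain B \<Longrightarrow> card B \<le> d"
  shows "\<exists>f::'a \<Rightarrow> nat. f ` S \<subseteq> {..<d} \<and> (\<forall>x\<in>S. \<forall>y\<in>S. f x = f y \<longrightarrow> x \<le> y \<or> y \<le> x)"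
proof -
  define E where "E = {(x::'a, y). \<not> x \<le> y \<and> \<not> y \<le> x}"
  have "\<exists>f. proper_coloring E d K f" if "finite K" "K \<subseteq> S" for K
  proof -
    have "card B \<le> d" if "B \<subseteq> K" "antichain B" for B
      using that \<open>K \<subseteq> S\<close> by (intro assms) auto
    from finite_chain_coloring[OF \<open>finite K\<close> this]
    obtain f :: "'a \<Rightarrow> nat" where "f ` K \<subseteq> {..<d}"
      "\<forall>x\<in>K. \<forall>y\<in>K. f x = f y \<longrightarrow> x \<le> y \<or> y \<le> x"
      by blast
    then have "proper_coloring E d K f"
      by (auto simp: proper_coloring_def E_def)
    then show ?thesis
      by blast
  qed
  then obtain f where "proper_coloring E d S f"
    using coloring_compactness[of S E d] by blast
  then show ?thesis
    by (intro exI[of _ f]) (auto simp: proper_coloring_def E_def)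
qed

section \<open>Maximal chains in Dilworth partitions\<close>

lemma chain_less_iff:
  "pred_on.chain S (<) C \<longleftrightarrow> C \<subseteq> S \<and> (\<forall>x\<in>C. \<forall>y\<in>C. x \<le> y \<or> y \<le> x)" for C :: "'a::order set"
  by (auto simp: pred_on.chain_def order_le_less)

text \<open>Zorn's lemma for the chains containing \<open>C\<close>: any two points of a union of
  nested chains lie in one of them.\<close>

lemma chain_extends_to_maxchain:
  fixes C :: "'a::order set"
  assumes "pred_on.chain S (<) C"
  shows "\<exists>M. pred_on.maxchain S (<) M \<and> C \<subseteq> M"
proof -
  define \<A> where "\<A> = {D. pred_on.chain S (<) D \<and> C \<subseteq> D}"
  have "\<exists>M\<in>\<A>. \<forall>X\<in>\<A>. M \<subseteq> X \<longrightarrow> X = M"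
  proof (rule subset_Zorn_nonempty)
    show "\<A> \<noteq> {}"
      using assms by (auto simp: \<A>_def)
    fix \<C> assume \<C>: "\<C> \<noteq> {}" "subset.chain \<A> \<C>"
    have "x \<le> y \<or> y \<le> x" if xy: "x \<in> \<Union>\<C>" "y \<in> \<Union>\<C>" for x y
    proof -
      obtain D where "D \<in> \<C>" "{x, y} \<subseteq> D"
        using finite_subset_Union_chain[OF _ _ \<C>, of "{x, y}"] xy by auto
      then show ?thesis
        using \<C> by (fastforce simp: \<A>_def subset.chain_def chain_less_iff)
    qed
    moreover have "\<C> \<subseteq> \<A>"
      using \<C> by (simp add: subset.chain_def)
    then have "C \<subseteq> \<Union>\<C>" "\<Union>\<C> \<subseteq> S"
      using \<C>(1) unfolding \<A>_def chain_less_iff by blast+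
    ultimately show "\<Union>\<C> \<in> \<A>"
      unfolding \<A>_def chain_less_iff by blast
  qed
  then obtain M where M: "M \<in> \<A>" "\<And>X. X \<in> \<A> \<Longrightarrow> M \<subseteq> X \<Longrightarrow> X = M"
    by blast
  then have "pred_on.maxchain S (<) M"
    by (auto simp: \<A>_def pred_on.maxchain_def)
  then show ?thesis
    using M by (auto simp: \<A>_def)
qed

text \<open>The chains of a Dilworth partition are labelled by the elements of a maximum antichain. Any
  chain of such a partition may be enlarged to a maximal chain at the expense of the others.\<close>

lemma chain_labelling_with_maxchain:
  fixes S A :: "'a::order set"
  assumes width: "\<And>B. B \<subseteq> S \<Longrightarrow> antichain B \<Longrightarrow> card B \<le> card A"
    and A: "A \<subseteq> S" "antichain A" and a0: "a0 \<in> A"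
  shows "\<exists>c. c ` S \<subseteq> A \<and> (\<forall>a\<in>A. c a = a) \<and>
    (\<forall>x\<in>S. \<forall>y\<in>S. c x = c y \<longrightarrow> x \<le> y \<or> y \<le> x) \<and>
    pred_on.maxchain S (<) {x \<in> S. c x = a0}"
proof -
  obtain f :: "'a \<Rightarrow> nat" where f: "f ` S \<subseteq> {..<card A}"
    "\<And>x y. x \<in> S \<Longrightarrow> y \<in> S \<Longrightarrow> f x = f y \<Longrightarrow> x \<le> y \<or> y \<le> x"
    using chain_coloring[OF width] by metis
  have inj: "inj_on f A"
    using f(2) A unfolding inj_on_def antichain_def by blast
  then have img: "f ` A = {..<card A}"
    using f(1) A by (intro card_subset_eq) (auto simp: card_image)
  define C where "C = {x \<in> S. f x = f a0}"
  have "pred_on.chain S (<) C"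
    using f(2) by (auto simp: C_def chain_less_iff)
  then obtain M where M: "pred_on.maxchain S (<) M" "C \<subseteq> M"
    using chain_extends_to_maxchain by blast
  then have MS: "M \<subseteq> S" and Mch: "\<And>x y. x \<in> M \<Longrightarrow> y \<in> M \<Longrightarrow> x \<le> y \<or> y \<le> x"
    by (auto simp: pred_on.maxchain_def chain_less_iff)
  have "a0 \<in> M"
    using M a0 A by (auto simp: C_def)
  \<comment> \<open>\<open>M\<close> takes the label \<open>a0\<close>; every other point gets the
    element of \<open>A\<close> of its own colour, which is not \<open>a0\<close> because
    \<open>C \<subseteq> M\<close>.\<close>
  define c where "c x = (if x \<in> M then a0 else the_inv_into A f (f x))" for x
  have f_c: "f (c x) = f x \<and> c x \<in> A" if "x \<in> S - M" for x
  proof -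
    have "f x \<in> f ` A"
      using f(1) img that by auto
    then show ?thesis
      using that inj by (simp add: c_def f_the_inv_into_f the_inv_into_into)
  qed
  have "c x = a0 \<longleftrightarrow> x \<in> M" if "x \<in> S" for x
    using f_c[of x] that M(2) by (auto simp: c_def C_def)
  moreover have "x \<le> y \<or> y \<le> x" if "x \<in> S" "y \<in> S" "c x = c y" for x y
    using calculation that f(2) f_c Mch by (metis Diff_iff)
  moreover have "c a = a" if "a \<in> A" for a
  proof (cases "a \<in> M")
    case True
    then show ?thesis
      using \<open>a0 \<in> M\<close> Mch[of a a0] A that a0 by (auto simp: c_def antichain_def)
  next
    case False
    then show ?thesis
      using inj that by (simp add: c_def the_inv_into_f_f)
  qed
  moreover have "{x \<in> S. c x = a0} = M"
    using calculation(1) MS by auto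
  moreover have "c ` S \<subseteq> A"
    using f_c a0 by (auto simp: c_def)
  ultimately show ?thesis
    using M(1) by (intro exI[of _ c]) auto
qed

section \<open>Equivariant extension of a labelling\<close>

text \<open>Negative powers and the laws of exponents come from the group of permutations of
  \<open>A\<close>, whose elements are extensional functions; hence the restriction of
  \<open>\<tau>\<close>.\<close>

lemma int_powers_of_bij_betw:
  assumes "bij_betw \<tau> A A"
  obtains t :: "int \<Rightarrow> 'a \<Rightarrow> 'a"
  where "\<And>n a. a \<in> A \<Longrightarrow> t n a \<in> A"
    and "\<And>a. a \<in> A \<Longrightarrow> t 0 a = a"
    and "\<And>a. a \<in> A \<Longrightarrow> t 1 a = \<tau> a"
    and "\<And>m n a. a \<in> A \<Longrightarrow> t (m + n) a = t m (t n a)"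
proof -
  interpret group "BijGroup A"
    by (rule group_BijGroup)
  define t where "t n = restrict \<tau> A [^]\<^bsub>BijGroup A\<^esub> n" for n :: int
  have \<tau>: "restrict \<tau> A \<in> carrier (BijGroup A)"
    using assms by (auto simp: BijGroup_def Bij_def cong: bij_betw_cong)
  then have t_Bij: "t n \<in> Bij A" for n
    using int_pow_closed[OF \<tau>, of n] by (simp add: t_def BijGroup_def)
  show thesis
  proof (rule that[of t])
    show "t n a \<in> A" if "a \<in> A" for n a
      using Bij_imp_funcset[OF t_Bij] that by auto
    show "t 0 a = a" if "a \<in> A" for a
      using that by (simp add: t_def) (simp add: BijGroup_def)
    show "t 1 a = \<tau> a" if "a \<in> A" for a
      using that \<tau> by (simp add: t_def)
    show "t (m + n) a = t m (t n a)" if "a \<in> A" for m n a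
    proof -
      have "t (m + n) = t m \<otimes>\<^bsub>BijGroup A\<^esub> t n"
        unfolding t_def using \<tau> by (rule int_pow_mult)
      also have "\<dots> = compose A (t m) (t n)"
        using t_Bij by (simp add: BijGroup_def)
      finally show ?thesis
        using that by (simp add: compose_eq)
    qed
  qed
qed

text \<open>\<open>Z n\<close> abstracts the action of the \<open>n\<close>-th power of the
  generator. \<open>maximal\<close> is what a width equal to the cardinality of \<open>A\<close>
  provides: no point can be added to the antichain.\<close>

locale descending_antichain =
  fixes Z :: "int \<Rightarrow> 'a::order \<Rightarrow> 'a" and A :: "'a set"
  assumes Z_zero: "Z 0 p = p"
    and Z_add: "Z (m + n) p = Z m (Z n p)"
    and Z_mono: "p \<le> q \<Longrightarrow> Z n p \<le> Z n q"
    and antichain: "antichain A"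
    and maximal: "(\<exists>a\<in>A. p \<le> a) \<or> (\<exists>a\<in>A. a \<le> p)"
    and descending: "a \<in> A \<Longrightarrow> a' \<in> A \<Longrightarrow> \<not> a' < Z 1 a"
    and spanning_above: "\<exists>a\<in>A. \<exists>r. p \<le> Z r a"
    and spanning_below: "\<exists>a\<in>A. \<exists>s. Z s a \<le> p"
begin

section \<open>The set [A, gA] and its translates\<close>

definition Q :: "'a set" where "Q = between A (Z 1 ` A)"

lemma Z_cancel [simp]: "Z n (Z (- n) p) = p" "Z (- n) (Z n p) = p"
  by (simp_all flip: Z_add add: Z_zero)

lemma Z_le_iff: "Z n p \<le> Z n q \<longleftrightarrow> p \<le> q"
  using Z_mono[of p q n] Z_mono[of "Z n p" "Z n q" "- n"] by auto

lemma Z_le_shift_left: "Z n p \<le> q \<longleftrightarrow> p \<le> Z (- n) q"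
  using Z_le_iff[of n p "Z (- n) q"] by simp

lemma Z_le_shift_right: "q \<le> Z n p \<longleftrightarrow> Z (- n) q \<le> p"
  using Z_le_iff[of n "Z (- n) q" p] by simp

lemma Z_inject: "Z n p = Z n q \<longleftrightarrow> p = q"
  by (metis Z_cancel(2))

text \<open>By maximality \<open>Z 1 a\<close> is comparable to some element of \<open>A\<close>,
  and descent forbids it to lie strictly above one.\<close>

lemma translate_below: "a \<in> A \<Longrightarrow> \<exists>b\<in>A. Z 1 a \<le> b"
  using maximal[of "Z 1 a"] descending[of a] by (auto simp: order_le_less)

text \<open>The same dichotomy for \<open>Z (- 1) a\<close>: in the wrong case
  \<open>a \<le> Z 1 b\<close>, and descent leaves only equality.\<close>

lemma above_translate: "a \<in> A \<Longrightarrow> \<exists>b\<in>A. Z 1 b \<le> a"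
proof -
  assume a: "a \<in> A"
  consider b where "b \<in> A" "Z (- 1) a \<le> b" | b where "b \<in> A" "b \<le> Z (- 1) a"
    using maximal[of "Z (- 1) a"] by blast
  then show ?thesis
  proof cases
    case 1
    then have "a \<le> Z 1 b"
      by (simp add: Z_le_shift_right)
    then have "a = Z 1 b"
      using descending[OF 1(1) a] by simp
    then show ?thesis
      using 1 by blast
  qed (use Z_le_shift_left in blast)
qed

text \<open>By the two preceding lemmas, upper bounds may always be taken in \<open>A\<close> and
  lower bounds in its translate.\<close>

lemma mem_Q_iff: "p \<in> Q \<longleftrightarrow> (\<exists>a\<in>A. p \<le> a) \<and> (\<exists>a\<in>A. Z 1 a \<le> p)"
proof
  assume "p \<in> Q"
  then obtain x y where "x \<in> A \<union> Z 1 ` A" "y \<in> A \<union> Z 1 ` A" "p \<le> x" "y \<le> p"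
    by (auto simp: Q_def between_def)
  moreover have "\<exists>a\<in>A. x \<le> a" "\<exists>a\<in>A. Z 1 a \<le> x" if "x \<in> A \<union> Z 1 ` A" for x
    using that translate_below above_translate by auto
  ultimately show "(\<exists>a\<in>A. p \<le> a) \<and> (\<exists>a\<in>A. Z 1 a \<le> p)"
    by (meson order_trans)
qed (auto simp: Q_def between_def)

lemma A_subset_Q: "A \<subseteq> Q"
  using above_translate by (auto simp: mem_Q_iff)

lemma translate_mem_Q: "a \<in> A \<Longrightarrow> Z 1 a \<in> Q"
  using translate_below by (auto simp: mem_Q_iff)

text \<open>Every \<open>n\<close> has \<open>p\<close> below or above some element of \<open>Z n ` A\<close>, the first case occurs, and the second
  one holds for all large \<open>n\<close>. So somewhere the first case at \<open>n\<close> is followed by the second at \<open>n + 1\<close>.\<close>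

lemma Q_translates_cover: "\<exists>n. \<exists>x\<in>Q. p = Z n x"
proof (rule ccontr)
  define D where "D n \<longleftrightarrow> (\<exists>a\<in>A. Z (- n) p \<le> a)" for n
  define U where "U n \<longleftrightarrow> (\<exists>a\<in>A. a \<le> Z (- n) p)" for n
  assume none: "\<not> (\<exists>n. \<exists>x\<in>Q. p = Z n x)"
  have D_or_U: "D n \<or> U n" for n
    using maximal by (auto simp: D_def U_def)
  have "Z (- n) p = Z 1 (Z (- (n + 1)) p)" for n
    by (simp flip: Z_add)
  then have U_Suc_iff: "U (n + 1) \<longleftrightarrow> (\<exists>a\<in>A. Z 1 a \<le> Z (- n) p)" for n
    unfolding U_def using Z_le_iff by metis
  have no_both: "\<not> (D n \<and> U (n + 1))" for n
  proof
    assume "D n \<and> U (n + 1)"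
    then have "Z (- n) p \<in> Q"
      by (simp add: mem_Q_iff D_def U_Suc_iff)
    then show False
      using none Z_cancel(1)[of n p] by metis
  qed
  have U_Suc: "U (n + 1)" if "U n" for n
  proof -
    from that obtain a where a: "a \<in> A" "a \<le> Z (- n) p"
      by (auto simp: U_def)
    moreover obtain b where "b \<in> A" "Z 1 b \<le> a"
      using above_translate a by blast
    ultimately show ?thesis
      unfolding U_Suc_iff by (meson order_trans)
  qed
  obtain r s where "D r" "U s"
    using spanning_above[of p, unfolded Z_le_shift_right]
      spanning_below[of p, unfolded Z_le_shift_left]
    unfolding D_def U_def by blast
  \<comment> \<open>\<open>D n\<close> rules out \<open>U (n + 1)\<close>, so
    \<open>D (n + 1)\<close> is all that remains. Both families thus persist upwards and clash
    beyond \<open>r\<close> and \<open>s\<close>.\<close>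
  have "D n" if "r \<le> n" for n
    using that by (induction n rule: int_ge_induct) (use \<open>D r\<close> no_both D_or_U in blast)+
  moreover have "U n" if "s \<le> n" for n
    using that by (induction n rule: int_ge_induct) (use \<open>U s\<close> U_Suc in blast)+
  ultimately have "D (max r s)" "U (max r s + 1)"
    by simp_all
  then show False
    using no_both by blast
qed

end

text \<open>A labelling \<open>c\<close> of \<open>Q\<close> by \<open>A\<close> with chains as fibres matches the element \<open>a\<close> of \<open>A\<close> with the
  element \<open>b\<close> such that \<open>Z 1 b\<close> lies in the fibre of \<open>a\<close>. Gluing translates of the fibres along
  this matching extends the labelling to all of the poset; \<open>t 1\<close> is the inverse of the matching.\<close>

locale labelled_descending_antichain = descending_antichain +
  fixes c :: "'a \<Rightarrow> 'a" and t :: "int \<Rightarrow> 'a \<Rightarrow> 'a"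
  assumes c_mem: "x \<in> Q \<Longrightarrow> c x \<in> A"
    and c_id: "a \<in> A \<Longrightarrow> c a = a"
    and c_chain: "x \<in> Q \<Longrightarrow> y \<in> Q \<Longrightarrow> c x = c y \<Longrightarrow> x \<le> y \<or> y \<le> x"
    and t_mem: "a \<in> A \<Longrightarrow> t n a \<in> A"
    and t_zero: "a \<in> A \<Longrightarrow> t 0 a = a"
    and t_one: "a \<in> A \<Longrightarrow> t 1 a = c (Z 1 a)"
    and t_add: "a \<in> A \<Longrightarrow> t (m + n) a = t m (t n a)"
begin

section \<open>Labels on overlapping translates\<close>

lemma t_cancel: "a \<in> A \<Longrightarrow> t n (t (- n) a) = a" "a \<in> A \<Longrightarrow> t (- n) (t n a) = a"
  by (simp_all flip: t_add add: t_zero)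

text \<open>Induction on \<open>k\<close>. The last step goes from \<open>z\<close> to
  \<open>Z 1 z\<close>, and \<open>z\<close> turns out to lie in \<open>A\<close>, where
  \<open>z\<close> is its own label and \<open>c (Z 1 z)\<close> is \<open>t 1 z\<close>.\<close>

lemma c_translate:
  assumes "x \<in> Q" "y \<in> Q" "x = Z (int k) y"
  shows "c x = t (int k) (c y)"
  using assms
proof (induction k arbitrary: x)
  case 0
  then show ?case
    by (simp add: Z_zero t_zero c_mem)
next
  case (Suc k)
  define z where "z = Z (int k) y"
  have x: "x = Z 1 z"
    using Suc.prems by (simp add: z_def flip: Z_add)
  have "\<exists>b\<in>A. Z (int k) y \<le> b" for k
  proof (induction k)
    case 0
    then show ?case
      using Suc.prems by (simp add: Z_zero mem_Q_iff)
  next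
    case (Suc k)
    then obtain b b' where "b \<in> A" "Z (int k) y \<le> b" "b' \<in> A" "Z 1 b \<le> b'"
      using translate_below by blast
    then have "Z (int (Suc k)) y \<le> b'"
      using Z_mono[of "Z (int k) y" b 1] by (simp add: Z_add)
    then show ?case
      using \<open>b' \<in> A\<close> by blast
  qed
  then obtain b where "b \<in> A" "z \<le> b"
    unfolding z_def by blast
  \<comment> \<open>\<open>x \<in> Q\<close> gives an element of \<open>A\<close> below
    \<open>z\<close>; squeezed between two elements of an antichain, \<open>z\<close> is one of
    them.\<close>
  moreover obtain a where "a \<in> A" "a \<le> z"
    using Suc.prems(1) by (auto simp: x mem_Q_iff Z_le_iff)
  ultimately have z: "z \<in> A"
    using antichain unfolding antichain_def by (metis order_antisym order_trans)
  then have "z = t (int k) (c y)"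
    using Suc.IH[of z] Suc.prems(2) A_subset_Q c_id z_def by auto
  then have "c x = t 1 (t (int k) (c y))"
    using x z t_one by simp
  then show ?case
    using Suc.prems(2) c_mem by (simp flip: t_add)
qed

text \<open>Makes the extended label independent of how a point is written as a translate. For
  \<open>m \<le> n\<close> it is \<open>c_translate\<close> with \<open>k = n - m\<close>, moved by
  \<open>t m\<close>.\<close>

lemma label_unique:
  assumes "x \<in> Q" "y \<in> Q" "Z m x = Z n y"
  shows "t m (c x) = t n (c y)"
proof -
  have main: "t m (c x) = t n (c y)"
    if "x \<in> Q" "y \<in> Q" "Z m x = Z n y" "m \<le> n" for m n x y
  proof -
    have "Z m x = Z m (Z (n - m) y)"
      using that(3) by (simp flip: Z_add)
    then have "x = Z (int (nat (n - m))) y"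
      using \<open>m \<le> n\<close> by (simp add: Z_inject)
    from c_translate[OF that(1,2) this] show ?thesis
      using that c_mem by (simp flip: t_add)
  qed
  show ?thesis
    using main[of x y m n] main[of y x n m] assms by (cases "m \<le> n") auto
qed

text \<open>The choice is harmless: \<open>Q_translates_cover\<close> provides a value and
  \<open>label_unique\<close> shows that there is only one.\<close>

definition label :: "'a \<Rightarrow> 'a" where
  "label p = (SOME a. \<exists>n. \<exists>x\<in>Q. p = Z n x \<and> a = t n (c x))"

lemma label_translate: "x \<in> Q \<Longrightarrow> label (Z n x) = t n (c x)"
  unfolding label_def by (rule some_equality) (use label_unique in metis)+

lemma label_on_Q: "x \<in> Q \<Longrightarrow> label x = c x"
  using label_translate[of x 0] by (simp add: Z_zero t_zero c_mem)

lemma label_mem: "label p \<in> A"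
  using Q_translates_cover[of p] label_translate c_mem t_mem by auto

lemma label_shift: "label (Z 1 p) = t 1 (label p)"
proof -
  obtain n x where "x \<in> Q" "p = Z n x"
    using Q_translates_cover by blast
  moreover from this have "Z 1 p = Z (1 + n) x"
    by (simp add: Z_add)
  ultimately show ?thesis
    using c_mem by (simp add: label_translate t_add)
qed

text \<open>\<open>spine a n\<close> is the element of \<open>Z n ` A\<close> with label \<open>a\<close>.\<close>

definition spine :: "'a \<Rightarrow> int \<Rightarrow> 'a" where
  "spine a n = Z n (t (- n) a)"

text \<open>The fibre of \<open>c\<close> through \<open>x\<close> contains \<open>Z 1 b\<close> and
  \<open>c x\<close>, so \<open>x\<close> is comparable to both. On the wrong side of either,
  \<open>x\<close> would be squeezed between two elements of an antichain and coincide with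
  it.\<close>

lemma fibre_between:
  assumes "x \<in> Q" "b \<in> A" "c x = t 1 b"
  shows "Z 1 b \<le> x" "x \<le> c x"
proof -
  have "x \<le> Z 1 b \<or> Z 1 b \<le> x"
    using c_chain[of x "Z 1 b"] assms translate_mem_Q t_one by auto
  moreover have "x = Z 1 b" if le: "x \<le> Z 1 b"
  proof -
    obtain a where a: "a \<in> A" "Z 1 a \<le> x"
      using assms by (auto simp: mem_Q_iff)
    then have "Z 1 a \<le> Z 1 b"
      using le by simp
    then have "a = b"
      using antichain a assms(2) Z_le_iff by (auto simp: antichain_def)
    then show ?thesis
      using a le by simp
  qed
  ultimately show "Z 1 b \<le> x"
    by auto
  have "x \<le> c x \<or> c x \<le> x"
    using c_chain[of x "c x"] c_id[OF c_mem] c_mem A_subset_Q assms(1) by auto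
  moreover have "x = c x" if le: "c x \<le> x"
  proof -
    obtain a where a: "a \<in> A" "x \<le> a"
      using assms by (auto simp: mem_Q_iff)
    then have "c x \<le> a"
      using le by simp
    then have "a = c x"
      using antichain a c_mem[OF assms(1)] by (auto simp: antichain_def)
    then show ?thesis
      using a le by simp
  qed
  ultimately show "x \<le> c x"
    by auto
qed

lemma spine_bounds:
  assumes "x \<in> Q"
  shows "spine (label (Z n x)) (n + 1) \<le> Z n x" "Z n x \<le> spine (label (Z n x)) n"
proof -
  \<comment> \<open>\<open>Z 1 b\<close> is the bottom of the fibre through \<open>x\<close>; both
    bounds are those of \<open>fibre_between\<close> translated by \<open>n\<close>.\<close>
  define b where "b = t (- 1) (c x)"
  have b: "b \<in> A" "c x = t 1 b"
    using assms c_mem t_mem t_cancel by (auto simp: b_def)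
  have "t (- (n + 1)) (label (Z n x)) = b"
    using assms c_mem by (simp add: b_def label_translate flip: t_add)
  then show "spine (label (Z n x)) (n + 1) \<le> Z n x"
    using fibre_between(1)[OF assms b] by (simp add: spine_def Z_add Z_le_iff)
  have "t (- n) (label (Z n x)) = c x"
    using assms c_mem by (simp add: label_translate t_cancel)
  then show "Z n x \<le> spine (label (Z n x)) n"
    using fibre_between(2)[OF assms b] by (simp add: spine_def Z_le_iff)
qed

text \<open>\<open>spine a n\<close> lies in the \<open>n\<close>-th translate of \<open>A\<close>
  and has label \<open>a\<close>, so \<open>spine_bounds\<close> puts \<open>spine a (n + 1)\<close>
  below it.\<close>

lemma spine_antimono:
  assumes "a \<in> A" "m \<le> n"
  shows "spine a n \<le> spine a m"
  using assms(2)
proof (induction n rule: int_ge_induct)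
  case (step n)
  define b where "b = t (- n) a"
  have "b \<in> A"
    using assms by (simp add: b_def t_mem)
  then have "label (Z n b) = a" "spine a n = Z n b"
    using assms A_subset_Q by (auto simp: b_def label_translate c_id t_cancel spine_def)
  then have "spine a (n + 1) \<le> spine a n"
    using spine_bounds(1)[of b n] \<open>b \<in> A\<close> A_subset_Q by auto
  then show ?case
    using step.IH by simp
qed simp

text \<open>Points from different translates are separated by the spine, the larger index lying
  lower. Points from one translate come from points of \<open>Q\<close> with equal \<open>c\<close>,
  since \<open>t m\<close> is injective on \<open>A\<close>.\<close>

lemma label_chain:
  assumes "label p = label q"
  shows "p \<le> q \<or> q \<le> p"
proof -
  obtain m x n y where xy: "x \<in> Q" "p = Z m x" "y \<in> Q" "q = Z n y"
    using Q_translates_cover by metis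
  have less: "Z n y \<le> Z m x"
    if "x \<in> Q" "y \<in> Q" "label (Z m x) = label (Z n y)" "m < n" for x y m n
  proof -
    have "Z n y \<le> spine (label (Z n y)) n"
      using spine_bounds that by blast
    also have "\<dots> \<le> spine (label (Z n y)) (m + 1)"
      using spine_antimono label_mem \<open>m < n\<close> by simp
    also have "\<dots> \<le> Z m x"
      using spine_bounds(1)[of x m] that by simp
    finally show ?thesis .
  qed
  consider "m < n" | "m = n" | "n < m"
    by linarith
  then show ?thesis
  proof cases
    case 2
    then have "c x = c y"
      using assms xy label_translate t_cancel(2) c_mem by metis
    then show ?thesis
      using c_chain xy 2 Z_le_iff by simp
  qed (use less xy assms in auto)
qed

section \<open>The fibres of the label as the invariant partition\<close>

definition fibre :: "'a \<Rightarrow> 'a set" where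
  "fibre a = {p. label p = a}"

lemma mem_fibre: "a \<in> A \<Longrightarrow> a \<in> fibre a"
  using label_on_Q c_id A_subset_Q by (auto simp: fibre_def)

lemma inj_on_fibre: "inj_on fibre A"
  using mem_fibre by (fastforce simp: inj_on_def fibre_def)

lemma fibre_Int_Q: "fibre a \<inter> Q = {x \<in> Q. c x = a}"
  using label_on_Q by (auto simp: fibre_def)

lemma chain_partition_fibres:
  assumes "finite A"
  shows "chain_partition UNIV (card A) (fibre ` A)"
proof -
  have "partition_on UNIV (fibre ` A)"
    using label_mem mem_fibre by (auto simp: partition_on_def disjoint_def fibre_def)
  then show ?thesis
    using assms label_chain card_image[OF inj_on_fibre]
    by (auto simp: chain_partition_def chain_less_iff) (auto simp: fibre_def)
qed

text \<open>No fibre becomes empty and no two merge, because each keeps its own label,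
  \<open>A\<close> being part of \<open>Q\<close>.\<close>

lemma chain_partition_fibres_Int_Q:
  assumes "finite A"
  shows "chain_partition Q (card A) ((\<lambda>C. C \<inter> Q) ` fibre ` A)"
proof -
  have mem: "a \<in> fibre a \<inter> Q" if "a \<in> A" for a
    using mem_fibre A_subset_Q that by auto
  have "inj_on (\<lambda>a. fibre a \<inter> Q) A"
    by (rule inj_onI) (use mem in \<open>force simp: fibre_def\<close>)
  moreover have "partition_on Q ((\<lambda>a. fibre a \<inter> Q) ` A)"
    using label_mem mem by (auto simp: partition_on_def disjoint_def fibre_def)
  ultimately show ?thesis
    using assms label_chain card_image[of "\<lambda>a. fibre a \<inter> Q" A]
    by (auto simp: chain_partition_def chain_less_iff image_image) (auto simp: fibre_def)
qed

text \<open>By \<open>label_shift\<close>, \<open>Z 1\<close> maps the fibre of \<open>a\<close>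
  onto that of \<open>t 1 a\<close>, and \<open>t 1\<close> permutes \<open>A\<close>.\<close>

lemma invariant_fibres: "invariant_under (Z 1) (fibre ` A)"
proof -
  have surj: "Z 1 (Z (- 1) p) = p" for p
    using Z_cancel(1) .
  have shift: "Z 1 ` fibre a = fibre (t 1 a)" if "a \<in> A" for a
  proof
    show "Z 1 ` fibre a \<subseteq> fibre (t 1 a)"
      by (auto simp: fibre_def label_shift)
    show "fibre (t 1 a) \<subseteq> Z 1 ` fibre a"
    proof
      fix p assume "p \<in> fibre (t 1 a)"
      then have "t 1 (label (Z (- 1) p)) = t 1 a"
        using label_shift[of "Z (- 1) p"] surj by (simp add: fibre_def)
      then have "label (Z (- 1) p) = a"
        using t_cancel(2) label_mem that by metis
      then show "p \<in> Z 1 ` fibre a"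
        using surj[of p] by (force simp: fibre_def)
    qed
  qed
  have img: "t 1 ` A = A"
  proof
    show "t 1 ` A \<subseteq> A"
      using t_mem by auto
    show "A \<subseteq> t 1 ` A"
      using t_mem t_cancel(1) by (metis imageI subsetI)
  qed
  have "image (Z 1) ` fibre ` A = (\<lambda>a. fibre (t 1 a)) ` A"
    using shift by (simp add: image_image)
  also have "\<dots> = fibre ` t 1 ` A"
    by (simp add: image_image)
  finally have "image (Z 1) ` fibre ` A = fibre ` A"
    by (simp add: img)
  moreover have "inj (Z 1)"
    by (rule injI) (simp add: Z_inject)
  ultimately show ?thesis
    by (auto simp: invariant_under_def bij_betw_def inj_on_def inj_image_eq_iff)
qed

end

theorem lemma5p3:
  fixes G :: "('b, 'c) monoid_scheme"
    and g :: 'b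
    and \<phi> :: "'b \<Rightarrow> 'a::order \<Rightarrow> 'a"
    and d :: nat
    and A :: "'a set"
  assumes "has_width (UNIV :: 'a set) d"
    and "group G" and "g \<in> carrier G" and "carrier G = generate G {g}" and "infinite (carrier G)"
    and "group_action G (UNIV :: 'a set) \<phi>"
    and order_preserving: "\<And>h. h \<in> carrier G \<Longrightarrow> mono (\<phi> h)"
    and free: "\<And>h p. h \<in> carrier G \<Longrightarrow> \<phi> h p = p \<Longrightarrow> h = \<one>\<^bsub>G\<^esub>"
    and "antichain A" and "card A = d"
    and "descending \<phi> g A"
    and "spans G \<phi> g A UNIV"
  shows "\<exists>\<C>. chain_partition (UNIV :: 'a set) d \<C> \<and>
             invariant_under (\<phi> g) \<C> \<and>
             dilworth_partition (between A (\<phi> g ` A)) ((\<lambda>C. C \<inter> between A (\<phi> g ` A)) ` \<C>) \<and>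
             (\<exists>M \<in> (\<lambda>C. C \<inter> between A (\<phi> g ` A)) ` \<C>.
                pred_on.maxchain (between A (\<phi> g ` A)) (<) M)"
proof -
  interpret group G by fact
  interpret group_action G UNIV \<phi> by fact
  define Z where "Z n = \<phi> (g [^]\<^bsub>G\<^esub> n)" for n :: int
  have Z1: "Z 1 = \<phi> g"
    using \<open>g \<in> carrier G\<close> by (simp add: Z_def)
  have width: "finite B \<and> card B \<le> d" if "antichain B" for B :: "'a set"
    using \<open>has_width UNIV d\<close> that by (simp add: has_width_def)
  have "finite A"
    using width \<open>antichain A\<close> by blast
  interpret descending_antichain Z A
  proof
    show "Z 0 p = p" for p
      by (simp add: Z_def id_eq_one[symmetric])
    show "Z (m + n) p = Z m (Z n p)" for m n p
      using \<open>g \<in> carrier G\<close> by (simp add: Z_def int_pow_mult composition_rule)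
    show "Z n p \<le> Z n q" if "p \<le> q" for n p q
      using order_preserving[of "g [^]\<^bsub>G\<^esub> n"] that \<open>g \<in> carrier G\<close>
      by (simp add: Z_def mono_def)
    show "(\<exists>a\<in>A. p \<le> a) \<or> (\<exists>a\<in>A. a \<le> p)" for p
    proof (rule ccontr)
      assume none: "\<not> ((\<exists>a\<in>A. p \<le> a) \<or> (\<exists>a\<in>A. a \<le> p))"
      then have "antichain (insert p A)" "p \<notin> A"
        using \<open>antichain A\<close> by (auto simp: antichain_def)
      then show False
        using width[of "insert p A"] \<open>finite A\<close> \<open>card A = d\<close> by simp
    qed
    show "\<not> a' < Z 1 a" if "a \<in> A" "a' \<in> A" for a a'
      using \<open>descending \<phi> g A\<close> that by (simp add: Z1 descending_def)
    show "\<exists>a\<in>A. \<exists>r. p \<le> Z r a" "\<exists>a\<in>A. \<exists>s. Z s a \<le> p" for p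
      using \<open>spans G \<phi> g A UNIV\<close> unfolding spans_def Z_def by (meson UNIV_I less_imp_le)+
  qed fact
  \<comment> \<open>Any element of \<open>A\<close> will do; its fibre is the one that meets
    \<open>Q\<close> in a maximal chain.\<close>
  obtain a0 where "a0 \<in> A"
    using spanning_above by blast
  obtain c where c: "c ` Q \<subseteq> A" "\<And>a. a \<in> A \<Longrightarrow> c a = a"
    "\<And>x y. x \<in> Q \<Longrightarrow> y \<in> Q \<Longrightarrow> c x = c y \<Longrightarrow> x \<le> y \<or> y \<le> x"
    "pred_on.maxchain Q (<) {x \<in> Q. c x = a0}"
    using chain_labelling_with_maxchain[OF _ A_subset_Q antichain \<open>a0 \<in> A\<close>] width \<open>card A = d\<close>
    by metis
  \<comment> \<open>Translated points with equal labels are comparable, hence equal; as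
    \<open>A\<close> is finite, this map is a permutation of \<open>A\<close> and has integer
    powers.\<close>
  have "inj_on (\<lambda>a. c (Z 1 a)) A"
  proof (rule inj_onI)
    fix a b assume "a \<in> A" "b \<in> A" "c (Z 1 a) = c (Z 1 b)"
    then have "a \<le> b \<or> b \<le> a"
      using c(3)[of "Z 1 a" "Z 1 b"] translate_mem_Q Z_le_iff by simp
    then show "a = b"
      using antichain \<open>a \<in> A\<close> \<open>b \<in> A\<close> by (auto simp: antichain_def)
  qed
  moreover have "(\<lambda>a. c (Z 1 a)) ` A \<subseteq> A"
    using c(1) translate_mem_Q by auto
  ultimately have "bij_betw (\<lambda>a. c (Z 1 a)) A A"
    using \<open>finite A\<close> by (simp add: bij_betw_def endo_inj_surj)
  then obtain t :: "int \<Rightarrow> 'a \<Rightarrow> 'a" where t: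
    "\<And>n a. a \<in> A \<Longrightarrow> t n a \<in> A" "\<And>a. a \<in> A \<Longrightarrow> t 0 a = a"
    "\<And>a. a \<in> A \<Longrightarrow> t 1 a = c (Z 1 a)" "\<And>m n a. a \<in> A \<Longrightarrow> t (m + n) a = t m (t n a)"
    by (rule int_powers_of_bij_betw) blast
  have c_mem: "c x \<in> A" if "x \<in> Q" for x
    using c(1) that by blast
  interpret labelled_descending_antichain Z A c t
    by unfold_locales (fact c_mem c(2,3) t)+
  have Q: "between A (\<phi> g ` A) = Q"
    by (simp add: Q_def Z1)
  \<comment> \<open>\<open>A\<close> itself lies in \<open>Q\<close> and attains the width.\<close>
  have "has_width Q d"
    using width A_subset_Q antichain \<open>finite A\<close> \<open>card A = d\<close> by (auto simp: has_width_def)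
  then have "dilworth_partition Q ((\<lambda>C. C \<inter> Q) ` fibre ` A)"
    using chain_partition_fibres_Int_Q \<open>finite A\<close> \<open>card A = d\<close>
    by (auto simp: dilworth_partition_def)
  moreover have "fibre a0 \<inter> Q \<in> (\<lambda>C. C \<inter> Q) ` fibre ` A"
    using \<open>a0 \<in> A\<close> by blast
  moreover have "pred_on.maxchain Q (<) (fibre a0 \<inter> Q)"
    using c(4) by (simp add: fibre_Int_Q)
  ultimately show ?thesis
    using chain_partition_fibres invariant_fibres \<open>finite A\<close> \<open>card A = d\<close>
    unfolding Q Z1 by blast
qed

end
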